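(* If $G$ is an Eulerian graph with $n\ge 1$ non-isolated vertices and maximum degree at most $4$, then $\mathrm{cn}(G)\le\lfloor (n-1)/2\rfloor$.
   Context: All graphs are finite and simple. A graph is Eulerian if all of its vertices have even degree (it need not be connected). A cycle decomposition of an Eulerian graph $G$ is a set of pairwise edge-disjoint cycles of $G$ that together cover $E(G)$; $\mathrm{cn}(G)$ is the minimum size of a cycle decomposition of $G$. A vertex is isolated if it has degree $0$. *)

theory Defs
  imports Main
begin

text \<open>
  Graphs are pairs of a vertex set and an edge set; an edge is the set of its two endpoints.
\<close>

definition simple_graph :: "'a set \<Rightarrow> 'a set set \<Rightarrow> bool" where
  "simple_graph V E \<longleftrightarrow> finite V \<and> (\<forall>e\<in>E. e \<subseteq> V \<and> card e = 2)"

definition degree :: "'a set set \<Rightarrow> 'a \<Rightarrow> nat" where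
  "degree E v = card {e \<in> E. v \<in> e}"

text \<open>Meaningful only for finite nonempty \<open>V\<close>.\<close>

definition max_degree :: "'a set \<Rightarrow> 'a set set \<Rightarrow> nat" where
  "max_degree V E = Max (degree E ` V)"

definition eulerian :: "'a set \<Rightarrow> 'a set set \<Rightarrow> bool" where
  "eulerian V E \<longleftrightarrow> simple_graph V E \<and> (\<forall>v\<in>V. even (degree E v))"

definition isolated :: "'a set set \<Rightarrow> 'a \<Rightarrow> bool" where
  "isolated E v \<longleftrightarrow> degree E v = 0"

definition cycle_edges :: "'a list \<Rightarrow> 'a set set" where
  "cycle_edges vs = {{vs ! i, vs ! (Suc i mod length vs)} | i. i < length vs}"

text \<open>
  A cycle is identified with its edge set, which determines it as a subgraph: the vertex lists
  obtained from each other by rotation or reversal describe the same cycle.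
\<close>

definition is_cycle :: "'a set \<Rightarrow> 'a set set \<Rightarrow> 'a set set \<Rightarrow> bool" where
  "is_cycle V E C \<longleftrightarrow>
     (\<exists>vs. distinct vs \<and> length vs \<ge> 3 \<and> set vs \<subseteq> V \<and> C = cycle_edges vs \<and> C \<subseteq> E)"

definition cycle_decomposition :: "'a set \<Rightarrow> 'a set set \<Rightarrow> 'a set set set \<Rightarrow> bool" where
  "cycle_decomposition V E D \<longleftrightarrow>
     (\<forall>C\<in>D. is_cycle V E C) \<and> pairwise disjnt D \<and> \<Union>D = E"

text \<open>
  The minimum is over a nonempty set whenever the graph is Eulerian, since every Eulerian graph
  has a cycle decomposition.
\<close>

definition cn :: "'a set \<Rightarrow> 'a set set \<Rightarrow> nat" where
  "cn V E = (LEAST k. \<exists>D. cycle_decomposition V E D \<and> card D = k)"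

end

theory Submission
  imports Defs
begin

text \<open>
  Deleting the edges of a circuit costs one cycle of the decomposition, and suppressing a vertex of
  degree two whose neighbours are not adjacent costs nothing. By induction on the number of edges it
  therefore suffices to find a circuit after whose deletion two vertices can be suppressed. If there
  is no triangle, two consecutive vertices of any circuit will do. If there are triangles but no edge
  lies in two of them, consider the graph without the edges of a triangle: when two corners are still
  connected by a path, closing that path with the triangle edge gives a suitable circuit; otherwise
  the three corners lie in different components and the induction hypothesis is applied to each of
  them. If some edge \<open>uw\<close> lies in two triangles \<open>uwp\<close> and \<open>uwq\<close>, a short circuit through the
  neighbourhoods of \<open>u\<close> and \<open>w\<close> works, except that when \<open>u\<close> and \<open>w\<close> are twins with an independent
  set of three common neighbours one argues with a path or with components as before.
\<close>

subsection \<open>Paths, circuits and decompositions\<close>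

fun path_edges :: "'a list \<Rightarrow> 'a set set" where
  "path_edges (x # y # xs) = insert {x, y} (path_edges (y # xs))"
| "path_edges _ = {}"

definition is_circuit :: "'a set set \<Rightarrow> bool" where
  "is_circuit C \<longleftrightarrow> (\<exists>vs. distinct vs \<and> 3 \<le> length vs \<and> C = cycle_edges vs)"

definition nbrs :: "'a set set \<Rightarrow> 'a \<Rightarrow> 'a set" where
  "nbrs E v = {x. {v, x} \<in> E}"

text \<open>Graphs are reduced to their edge sets, so that the non-isolated vertices are exactly
  \<open>\<Union>E\<close>. The degree bound belongs to the invariant because deleting a circuit and
  suppressing a vertex both preserve it.\<close>

definition even_graph :: "'a set set \<Rightarrow> bool" where
  "even_graph E \<longleftrightarrow> finite E \<and> (\<forall>e\<in>E. card e = 2) \<and>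
     (\<forall>v. even (card (nbrs E v)) \<and> card (nbrs E v) \<le> 4)"

text \<open>The number is only an upper bound on the count of circuits: the empty graph accepts
  every \<open>k\<close>.\<close>

inductive decomposes :: "'a set set \<Rightarrow> nat \<Rightarrow> bool" where
  empty: "decomposes {} k"
| add: "is_circuit C \<Longrightarrow> C \<inter> E = {} \<Longrightarrow> decomposes E k \<Longrightarrow> decomposes (C \<union> E) (Suc k)"

lemma path_edges_conv_nth:
  "path_edges vs = (\<lambda>i. {vs ! i, vs ! Suc i}) ` {..<length vs - 1}"
proof (induction vs rule: path_edges.induct)
  case (1 x y xs)
  have "{..<length (x # y # xs) - 1} = insert 0 (Suc ` {..<length (y # xs) - 1})"
    by (simp add: lessThan_Suc_eq_insert_0)
  then show ?case using 1 by (simp add: image_image)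
qed auto

text \<open>Trades indices modulo the length for a path plus a closing edge, a form suited to
  induction and to evaluating concrete lists.\<close>

lemma cycle_edges_eq:
  assumes "vs \<noteq> []"
  shows "cycle_edges vs = insert {last vs, hd vs} (path_edges vs)"
proof -
  obtain m where m: "length vs = Suc m" using assms by (cases vs) auto
  have "cycle_edges vs = (\<lambda>i. {vs ! i, vs ! (Suc i mod length vs)}) ` {..<Suc m}"
    by (simp add: cycle_edges_def m setcompr_eq_image lessThan_def)
  also have "\<dots> = insert {vs ! m, vs ! 0} ((\<lambda>i. {vs ! i, vs ! Suc i}) ` {..<m})"
    unfolding lessThan_Suc image_insert m by (intro arg_cong2[of _ _ _ _ insert] image_cong) simp_all
  finally show ?thesis
    using assms m by (simp add: path_edges_conv_nth last_conv_nth hd_conv_nth)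
qed

lemma path_edges_snoc: "zs \<noteq> [] \<Longrightarrow> path_edges (zs @ [x]) = insert {last zs, x} (path_edges zs)"
  by (induction zs rule: path_edges.induct) (simp_all add: insert_commute)

lemma cycle_edges_rotate1: "cycle_edges (rotate1 vs) = cycle_edges vs"
proof (cases vs)
  case (Cons x xs)
  show ?thesis
  proof (cases xs)
    case (Cons y ys)
    have "cycle_edges (rotate1 vs) = insert {x, y} (path_edges ((y # ys) @ [x]))"
      using Cons \<open>vs = x # xs\<close> by (simp add: cycle_edges_eq)
    also have "\<dots> = insert {x, y} (insert {last (y # ys), x} (path_edges (y # ys)))"
      by (subst path_edges_snoc) auto
    also have "\<dots> = cycle_edges vs"
      using Cons \<open>vs = x # xs\<close> by (simp add: cycle_edges_eq insert_commute)
    finally show ?thesis .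
  qed (simp add: Cons)
qed simp

lemma path_edges_subset: "e \<in> path_edges vs \<Longrightarrow> e \<subseteq> set vs"
  by (induction vs rule: path_edges.induct) auto

lemma Union_path_edges: "2 \<le> length vs \<Longrightarrow> \<Union>(path_edges vs) = set vs"
proof (induction vs rule: path_edges.induct)
  case (1 x y xs)
  then show ?case by (cases xs) auto
qed auto

lemma Union_cycle_edges: "2 \<le> length vs \<Longrightarrow> \<Union>(cycle_edges vs) = set vs"
  using Union_path_edges[of vs] hd_in_set[of vs] last_in_set[of vs]
  by (cases "vs = []") (auto simp: cycle_edges_eq)

lemma cycle_edges_rotate: "cycle_edges (rotate k vs) = cycle_edges vs"
  by (induction k) (auto simp: cycle_edges_rotate1)

text \<open>Rotation keeps the edge set, so any vertex of the circuit can be moved to the front of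
  the list.\<close>

lemma circuit_at_vertex:
  assumes "is_circuit C" "v \<in> \<Union>C"
  obtains ys where "distinct (v # ys)" "2 \<le> length ys" "C = cycle_edges (v # ys)"
proof -
  obtain vs where vs: "distinct vs" "3 \<le> length vs" "C = cycle_edges vs"
    using assms(1) by (auto simp: is_circuit_def)
  then have "v \<in> set vs" using assms(2) Union_cycle_edges[of vs] by simp
  then obtain as bs where ab: "vs = as @ v # bs" by (auto simp: in_set_conv_decomp)
  have "rotate (length as) vs = v # bs @ as" unfolding ab by (simp add: rotate_append)
  moreover have "cycle_edges (rotate (length as) vs) = C" using vs by (simp add: cycle_edges_rotate)
  ultimately show ?thesis using that[of "bs @ as"] vs ab by auto
qed

text \<open>The only path edge at the head leads to the second vertex, which is not the last one
  when there are at least three.\<close>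

lemma closing_edge_notin:
  assumes "distinct vs" "3 \<le> length vs"
  shows "{last vs, hd vs} \<notin> path_edges vs"
proof -
  obtain x y z zs where "vs = x # y # z # zs"
    using assms(2) by (auto simp: numeral_3_eq_3 Suc_le_length_iff)
  then show ?thesis using assms path_edges_subset[of "{last vs, hd vs}" "y # z # zs"]
    by (auto simp: doubleton_eq_iff)
qed

lemma nbrs_Diff: "nbrs (E - C) v = nbrs E v - nbrs C v"
  by (auto simp: nbrs_def)

lemma nbrs_mono: "C \<subseteq> E \<Longrightarrow> nbrs C v \<subseteq> nbrs E v"
  by (auto simp: nbrs_def)

lemma nbrs_sym: "x \<in> nbrs E y \<longleftrightarrow> y \<in> nbrs E x"
  by (simp add: nbrs_def insert_commute)

lemma nbrs_path_hd:
  assumes "distinct (v # y # ys)"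
  shows "{x. {v, x} \<in> path_edges (v # y # ys)} = {y}"
  using assms path_edges_subset[of _ "y # ys"] by (auto simp: doubleton_eq_iff)

lemma nbrs_cycle_edges:
  assumes "distinct (v # ys)" "2 \<le> length ys"
  shows "nbrs (cycle_edges (v # ys)) v = {hd ys, last ys}"
proof -
  obtain y zs where ys: "ys = y # zs" "zs \<noteq> []"
    using assms(2) by (auto simp: numeral_2_eq_2 Suc_le_length_iff)
  have "nbrs (cycle_edges (v # ys)) v = insert (last ys) {x. {v, x} \<in> path_edges (v # y # zs)}"
    using ys assms by (auto simp: cycle_edges_eq nbrs_def doubleton_eq_iff)
  then show ?thesis using nbrs_path_hd[of v y zs] assms ys by auto
qed

text \<open>With \<open>v\<close> in front, its neighbours are the first and last of the remaining
  vertices, which differ because at least two remain.\<close>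

lemma card_nbrs_circuit:
  assumes "is_circuit C"
  shows "card (nbrs C v) = (if v \<in> \<Union>C then 2 else 0)"
proof (cases "v \<in> \<Union>C")
  case True
  then obtain ys where ys: "distinct (v # ys)" "2 \<le> length ys" "C = cycle_edges (v # ys)"
    using circuit_at_vertex assms by metis
  then obtain y zs where "ys = y # zs" "zs \<noteq> []"
    by (auto simp: numeral_2_eq_2 Suc_le_length_iff)
  then have "hd ys \<noteq> last ys" using ys(1) by auto
  with ys True nbrs_cycle_edges[OF ys(1,2)] show ?thesis by simp
next
  case False
  then have "nbrs C v = {}" by (auto simp: nbrs_def)
  then show ?thesis using False by (simp del: Union_iff)
qed

lemma card_Union_circuit:
  assumes "is_circuit C"
  shows "3 \<le> card (\<Union>C)"
proof -
  obtain vs where "distinct vs" "3 \<le> length vs" "C = cycle_edges vs"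
    using assms by (auto simp: is_circuit_def)
  then show ?thesis using Union_cycle_edges[of vs] by (simp add: distinct_card)
qed

lemma finite_Union_even_graph:
  assumes "even_graph E"
  shows "finite (\<Union>E)"
proof (rule finite_Union)
  show "finite e" if "e \<in> E" for e
    using that assms by (intro card_ge_0_finite) (auto simp: even_graph_def)
qed (use assms in \<open>simp add: even_graph_def\<close>)

lemma finite_nbrs:
  assumes "even_graph E"
  shows "finite (nbrs E v)"
  by (rule finite_subset[OF _ finite_Union_even_graph[OF assms]]) (auto simp: nbrs_def)

lemma nbrs_irrefl: "even_graph E \<Longrightarrow> v \<notin> nbrs E v"
  by (auto simp: even_graph_def nbrs_def)

lemma edge_obtain_nbrs:
  assumes "even_graph E" "e \<in> E" "v \<in> e"
  obtains x where "e = {v, x}" "x \<noteq> v" "x \<in> nbrs E v"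
proof -
  have "card e = 2" using assms by (simp add: even_graph_def)
  then obtain a b where e: "e = {a, b}" "a \<noteq> b" by (auto simp: card_2_iff)
  define x where "x = (if v = a then b else a)"
  have "e = {v, x}" "x \<noteq> v" using e assms(3) by (auto simp: x_def)
  then show ?thesis using that[of x] assms(2) by (simp add: nbrs_def)
qed

lemma Union_conv_nbrs:
  assumes "even_graph E"
  shows "v \<in> \<Union>E \<longleftrightarrow> nbrs E v \<noteq> {}"
proof
  assume "v \<in> \<Union>E"
  then show "nbrs E v \<noteq> {}" by (metis UnionE assms edge_obtain_nbrs empty_iff)
next
  assume "nbrs E v \<noteq> {}"
  then show "v \<in> \<Union>E" unfolding nbrs_def by blast
qed

lemma even_graph_Diff_circuit:
  assumes "even_graph E" "is_circuit C" "C \<subseteq> E"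
  shows "even_graph (E - C)"
proof -
  have "even (card (nbrs (E - C) v)) \<and> card (nbrs (E - C) v) \<le> 4" for v
  proof -
    have "nbrs C v \<subseteq> nbrs E v" "finite (nbrs C v)"
      using nbrs_mono[OF assms(3)] finite_nbrs[OF assms(1)] finite_subset by blast+
    then have "card (nbrs (E - C) v) = card (nbrs E v) - card (nbrs C v)"
      by (simp add: nbrs_Diff card_Diff_subset)
    moreover have "even (card (nbrs E v))" "card (nbrs E v) \<le> 4"
      using assms(1) by (auto simp: even_graph_def)
    ultimately show ?thesis using card_nbrs_circuit[OF assms(2), of v]
      by (cases "v \<in> \<Union>C") (simp_all del: Union_iff)
  qed
  then show ?thesis using assms(1) by (auto simp: even_graph_def)
qed

section \<open>Combining and rearranging decompositions\<close>

lemma decomposes_mono: "decomposes E k \<Longrightarrow> k \<le> l \<Longrightarrow> decomposes E l"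
proof (induction arbitrary: l rule: decomposes.induct)
  case (add C E k)
  then obtain m where "l = Suc m" "k \<le> m" by (cases l) auto
  then show ?case using add by (auto intro: decomposes.add)
qed (rule decomposes.empty)

lemma decomposes_Un:
  "decomposes E k \<Longrightarrow> decomposes F l \<Longrightarrow> E \<inter> F = {} \<Longrightarrow> decomposes (E \<union> F) (k + l)"
proof (induction rule: decomposes.induct)
  case (empty k)
  then show ?case using decomposes_mono[of F l "k + l"] by simp
next
  case (add C E k)
  have "E \<inter> F = {}" "C \<inter> (E \<union> F) = {}" using add.prems add.hyps by auto
  then show ?case using decomposes.add[OF add.hyps(1), of "E \<union> F" "k + l"] add
    by (simp add: Un_assoc)
qed

lemma decomposes_Diff:
  assumes "is_circuit C" "C \<subseteq> E" "decomposes (E - C) k"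
  shows "decomposes E (Suc k)"
  using decomposes.add[OF assms(1) _ assms(3)] assms(2) by (simp add: Un_absorb1)

text \<open>The circuits of a decomposition can be reordered, which brings the one through a
  prescribed edge to the front.\<close>

lemma decomposes_circuit_through:
  "decomposes E k \<Longrightarrow> e \<in> E \<Longrightarrow>
    \<exists>C F l. is_circuit C \<and> e \<in> C \<and> C \<inter> F = {} \<and> E = C \<union> F \<and> decomposes F l \<and> k = Suc l"
proof (induction rule: decomposes.induct)
  case (add C E k)
  show ?case
  proof (cases "e \<in> C")
    case True
    then show ?thesis using add.hyps by blast
  next
    case False
    then obtain C' F l where *: "is_circuit C'" "e \<in> C'" "C' \<inter> F = {}" "E = C' \<union> F"
      "decomposes F l" "k = Suc l" using add by blast
    have "decomposes (C \<union> F) (Suc l)" using add.hyps * by (intro decomposes.add) auto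
    moreover have "C' \<inter> (C \<union> F) = {}" "C \<union> E = C' \<union> (C \<union> F)" using add.hyps * by auto
    ultimately show ?thesis using * by blast
  qed
qed simp

text \<open>Once the circuit is rotated so that \<open>{a, b}\<close> is its closing edge,
  subdividing that edge means appending \<open>v\<close> to the list.\<close>

lemma circuit_subdivide:
  assumes "is_circuit C" "{a, b} \<in> C" "a \<noteq> b" "v \<notin> \<Union>C"
  shows "is_circuit (insert {v, a} (insert {v, b} (C - {{a, b}})))"
proof -
  obtain vs where vs: "distinct vs" "3 \<le> length vs" "C = cycle_edges vs"
    using assms(1) by (auto simp: is_circuit_def)
  obtain i where i: "i < length vs" "{a, b} = {vs ! i, vs ! (Suc i mod length vs)}"
    using assms(2) vs(3) by (auto simp: cycle_edges_def)
  \<comment> \<open>Rotating by \<open>Suc i\<close> starts the list just after edge number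
    \<open>i\<close>, which thereby becomes the closing edge.\<close>
  define ws where "ws = rotate (Suc i) vs"
  have ws: "distinct ws" "length ws = length vs" "C = cycle_edges ws"
    using vs by (simp_all add: ws_def cycle_edges_rotate del: rotate_Suc)
  have ne: "ws \<noteq> []" using ws vs by auto
  have "hd ws = vs ! (Suc i mod length vs)" using ne
    by (auto simp: ws_def hd_rotate_conv_nth simp del: rotate_Suc)
  moreover have "last ws = vs ! i"
  proof -
    have "last ws = vs ! ((Suc i + (length vs - 1)) mod length vs)"
      using ne ws(2) nth_rotate[of "length vs - 1" vs "Suc i"] i
      by (simp add: ws_def last_conv_nth del: rotate_Suc)
    moreover have "Suc i + (length vs - 1) = i + length vs" using i by simp
    ultimately show ?thesis using i by simp
  qed
  ultimately have ab: "{a, b} = {last ws, hd ws}" using i by simp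
  have rest: "C - {{a, b}} = path_edges ws"
    using closing_edge_notin[OF ws(1)] vs(2) unfolding ws(2,3) ab cycle_edges_eq[OF ne] by blast
  have new: "{{v, a}, {v, b}} = {{v, hd ws}, {last ws, v}}"
  proof -
    have "a = last ws \<and> b = hd ws \<or> a = hd ws \<and> b = last ws"
      using ab by (simp add: doubleton_eq_iff)
    then show ?thesis
    proof
      assume "a = last ws \<and> b = hd ws"
      then show ?thesis by (simp only: insert_commute)
    next
      assume "a = hd ws \<and> b = last ws"
      then show ?thesis by (simp only: insert_commute)
    qed
  qed
  have "insert {v, a} (insert {v, b} (C - {{a, b}})) = {{v, a}, {v, b}} \<union> path_edges ws"
    unfolding rest by blast
  also have "\<dots> = cycle_edges (ws @ [v])"
    unfolding new using ne by (simp add: cycle_edges_eq path_edges_snoc)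
  finally have "insert {v, a} (insert {v, b} (C - {{a, b}})) = cycle_edges (ws @ [v])" .
  moreover have "distinct (ws @ [v])" "3 \<le> length (ws @ [v])"
    using assms(4) Union_cycle_edges[of ws] ws vs by auto
  ultimately show ?thesis unfolding is_circuit_def by blast
qed

section \<open>Suppressing a vertex of degree two\<close>

definition suppress :: "'a set set \<Rightarrow> 'a \<Rightarrow> 'a \<Rightarrow> 'a \<Rightarrow> 'a set set" where
  "suppress E v a b = insert {a, b} (E - {{v, a}, {v, b}})"

text \<open>Each of \<open>a\<close> and \<open>b\<close> trades the neighbour \<open>v\<close> for
  the other one, so all degrees except that of \<open>v\<close> are kept; nonadjacency of
  \<open>a\<close> and \<open>b\<close> makes this trade possible in a simple graph.\<close>

lemma
  assumes E: "even_graph E" and v: "nbrs E v = {a, b}" and ab: "a \<noteq> b" "{a, b} \<notin> E"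
  shows nbrs_suppress: "nbrs (suppress E v a b) x =
      (if x = v then {} else if x = a then insert b (nbrs E a - {v})
       else if x = b then insert a (nbrs E b - {v}) else nbrs E x)" (is ?nbrs)
    and even_graph_suppress: "even_graph (suppress E v a b)"
    and card_suppress: "card (suppress E v a b) < card E"
    and card_Union_suppress: "card (\<Union>(suppress E v a b)) \<le> card (\<Union>E) - 1"
    and decomposes_suppress: "decomposes (suppress E v a b) k \<Longrightarrow> decomposes E k"
proof -
  have va: "v \<noteq> a" "v \<noteq> b" using nbrs_irrefl[OF E, of v] v by auto
  have inE: "{v, a} \<in> E" "{v, b} \<in> E" using v unfolding nbrs_def by blast+
  have ne: "{v, a} \<noteq> {v, b}" using ab(1) va by (simp add: doubleton_eq_iff)
  have nv: "nbrs (suppress E v a b) x =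
      (if x = v then {} else if x = a then insert b (nbrs E a - {v})
       else if x = b then insert a (nbrs E b - {v}) else nbrs E x)" for x
  proof -
    have mem: "z \<in> nbrs (suppress E v a b) x \<longleftrightarrow> {x, z} = {a, b} \<or>
        z \<in> nbrs E x \<and> {x, z} \<noteq> {v, a} \<and> {x, z} \<noteq> {v, b}" for z
      by (simp add: nbrs_def suppress_def)
    have "v \<in> nbrs E z \<longleftrightarrow> z = a \<or> z = b" for z
      using v nbrs_sym[of v E z] by simp
    then have vx: "v \<in> nbrs E x \<longleftrightarrow> x = a \<or> x = b" .
    show ?thesis
    proof (cases "x = v")
      case True
      then have "z \<notin> nbrs (suppress E v a b) x" for z
        using va v unfolding mem by (simp add: doubleton_eq_iff) blast
      then show ?thesis using True by auto
    next
      case False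
      then have "z \<in> nbrs (suppress E v a b) x \<longleftrightarrow>
          x = a \<and> z = b \<or> x = b \<and> z = a \<or> z \<in> nbrs E x \<and> z \<noteq> v" for z
        using va vx mem[of z] by (simp add: doubleton_eq_iff) metis
      then have "nbrs (suppress E v a b) x =
          {z. x = a \<and> z = b \<or> x = b \<and> z = a \<or> z \<in> nbrs E x \<and> z \<noteq> v}"
        by blast
      moreover have "v \<notin> nbrs E x" if "x \<noteq> a" "x \<noteq> b" using vx that by simp
      ultimately show ?thesis using False ab(1) by auto
    qed
  qed
  then show ?nbrs .
  have fin: "finite E" using E by (simp add: even_graph_def)
  have "card (nbrs (suppress E v a b) x) = (if x = v then 0 else card (nbrs E x))" for x
  proof -
    have "v \<in> nbrs E a" "v \<in> nbrs E b" "b \<notin> nbrs E a" "a \<notin> nbrs E b"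
      using inE ab by (auto simp: nbrs_def insert_commute)
    then have "card (insert b (nbrs E a - {v})) = card (nbrs E a)"
      "card (insert a (nbrs E b - {v})) = card (nbrs E b)"
      using finite_nbrs[OF E] card_Suc_Diff1[of "nbrs E a" v] card_Suc_Diff1[of "nbrs E b" v]
      by simp_all
    then show ?thesis by (simp add: nv)
  qed
  then show good: "even_graph (suppress E v a b)"
    using E ab fin by (auto simp: even_graph_def suppress_def)
  have "card (E - {{v, a}, {v, b}}) = card E - 2"
    using inE ab fin va ne by (simp add: card_Diff_subset)
  moreover have "2 \<le> card E"
    using card_mono[OF fin, of "{{v, a}, {v, b}}"] inE ne by simp
  ultimately show "card (suppress E v a b) < card E"
    using fin ab by (simp add: suppress_def card_insert_if)
  have "v \<notin> \<Union>(suppress E v a b)"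
    using Union_conv_nbrs[OF good, of v] nv[of v] by simp
  moreover have "\<Union>(suppress E v a b) \<subseteq> \<Union>E" using inE unfolding suppress_def by blast
  ultimately have sub: "\<Union>(suppress E v a b) \<subseteq> \<Union>E - {v}" by blast
  have "v \<in> \<Union>E" using inE by blast
  with sub show "card (\<Union>(suppress E v a b)) \<le> card (\<Union>E) - 1"
    using card_mono[OF _ sub] finite_Union_even_graph[OF E] by (simp add: card_Diff_singleton)
  \<comment> \<open>The circuit through the new edge is rerouted over \<open>v\<close>; the others
    avoid \<open>v\<close> and stay, so the count does not change.\<close>
  assume "decomposes (suppress E v a b) k"
  then obtain C F l where C: "is_circuit C" "{a, b} \<in> C" "C \<inter> F = {}" "suppress E v a b = C \<union> F"
    "decomposes F l" "k = Suc l"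
    using decomposes_circuit_through[of "suppress E v a b" k "{a, b}"] by (auto simp: suppress_def)
  let ?C = "insert {v, a} (insert {v, b} (C - {{a, b}}))"
  have "v \<notin> \<Union>C" using \<open>v \<notin> \<Union>(suppress E v a b)\<close> C(4) by auto
  then have "is_circuit ?C" by (rule circuit_subdivide[OF C(1,2) ab(1)])
  moreover have "F \<inter> {{v, a}, {v, b}} = {}"
    using \<open>v \<notin> \<Union>(suppress E v a b)\<close> C(4) by auto
  then have "?C \<inter> F = {}" using C(3) by auto
  moreover have "E = ?C \<union> F"
  proof -
    have "E = insert {v, a} (insert {v, b} (suppress E v a b - {{a, b}}))"
      using inE ab(2) unfolding suppress_def by blast
    also have "\<dots> = ?C \<union> F" using C by auto
    finally show ?thesis .
  qed
  ultimately show "decomposes E k" using decomposes.add[of ?C F l] C by simp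
qed

subsection \<open>Connectivity\<close>

definition connected_in :: "'a set set \<Rightarrow> 'a \<Rightarrow> 'a \<Rightarrow> bool" where
  "connected_in F x y \<longleftrightarrow> (x, y) \<in> {(a, b). {a, b} \<in> F}\<^sup>*"

lemma connected_in_refl: "connected_in F x x"
  by (simp add: connected_in_def)

lemma connected_in_trans: "connected_in F x y \<Longrightarrow> connected_in F y z \<Longrightarrow> connected_in F x z"
  unfolding connected_in_def by (rule rtrancl_trans)

lemma connected_in_sym: "connected_in F x y \<Longrightarrow> connected_in F y x"
proof -
  have "sym ({(a, b). {a, b} \<in> F}\<^sup>*)"
    by (rule sym_rtrancl) (auto simp: sym_def insert_commute)
  then show "connected_in F x y \<Longrightarrow> connected_in F y x" unfolding connected_in_def by (rule symD)
qed

lemma connected_in_edge: "{x, y} \<in> F \<Longrightarrow> connected_in F x y"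
  by (auto simp: connected_in_def)

lemma path_edges_append_subset: "path_edges xs \<subseteq> path_edges (xs @ ys)"
  by (induction xs rule: path_edges.induct) auto

lemma connected_in_path:
  assumes "connected_in F x y"
  obtains vs where "distinct vs" "vs \<noteq> []" "hd vs = x" "last vs = y" "path_edges vs \<subseteq> F"
proof -
  have "\<exists>vs. distinct vs \<and> vs \<noteq> [] \<and> hd vs = x \<and> last vs = y \<and> path_edges vs \<subseteq> F"
    using assms unfolding connected_in_def
  proof (induction rule: rtrancl_induct)
    case base
    then show ?case by (intro exI[of _ "[x]"]) simp
  next
    case (step y z)
    then obtain vs where vs: "distinct vs" "vs \<noteq> []" "hd vs = x" "last vs = y" "path_edges vs \<subseteq> F"
      by blast
    show ?case
    proof (cases "z \<in> set vs")
      \<comment> \<open>A return to a vertex already visited is cut off there, which keeps the list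
        distinct.\<close>
      case True
      then obtain as bs where ab: "vs = (as @ [z]) @ bs" by (auto simp: in_set_conv_decomp)
      then have "path_edges (as @ [z]) \<subseteq> F"
        using path_edges_append_subset[of "as @ [z]" bs] vs(5) by simp
      moreover have "hd (as @ [z]) = x" using ab vs(3) by (cases as) auto
      ultimately show ?thesis using ab vs(1) by (intro exI[of _ "as @ [z]"]) simp
    next
      case False
      then show ?thesis using vs step by (intro exI[of _ "vs @ [z]"]) (simp add: path_edges_snoc)
    qed
  qed
  then show ?thesis using that by blast
qed

text \<open>Such a set is a union of components together with arbitrary points off \<open>F\<close>;
  unlike single components, these sets are stable under union and complement.\<close>

definition component_closed :: "'a set set \<Rightarrow> 'a set \<Rightarrow> bool" where
  "component_closed F K \<longleftrightarrow> (\<forall>x y. {x, y} \<in> F \<longrightarrow> x \<in> K \<longrightarrow> y \<in> K)"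

lemma component_closed_connected: "component_closed F {y. connected_in F x y}"
  unfolding component_closed_def using connected_in_trans connected_in_edge by fast

lemma component_closed_Compl_Un:
  assumes "component_closed F K" "component_closed F L"
  shows "component_closed F (- (K \<union> L))"
  using assms unfolding component_closed_def by (metis ComplD ComplI UnE UnI1 UnI2 insert_commute)

lemma nbrs_restrict:
  assumes "component_closed F K"
  shows "nbrs {e \<in> F. e \<subseteq> K} v = (if v \<in> K then nbrs F v else {})"
  using assms unfolding component_closed_def nbrs_def by auto

lemma even_graph_restrict:
  assumes "even_graph F" "component_closed F K"
  shows "even_graph {e \<in> F. e \<subseteq> K}"
  using assms by (simp add: even_graph_def nbrs_restrict)

lemma component_closed_edge:
  assumes "even_graph F" "component_closed F K" "e \<in> F" "e \<inter> K \<noteq> {}"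
  shows "e \<subseteq> K"
proof -
  obtain x where x: "x \<in> e" "x \<in> K" using assms(4) by blast
  obtain y where "e = {x, y}" using edge_obtain_nbrs[OF assms(1,3) x(1)] by metis
  then show ?thesis using assms(2,3) x(2) by (auto simp: component_closed_def)
qed

section \<open>Explicit neighbourhoods and the existence of circuits\<close>

lemma fourth_nbr:
  assumes "even_graph E" "{a, b, c} \<subseteq> nbrs E v" "distinct [a, b, c]"
  obtains d where "nbrs E v = {a, b, c, d}" "distinct [v, a, b, c, d]"
proof -
  have fin: "finite (nbrs E v)" by (rule finite_nbrs[OF assms(1)])
  have "card {a, b, c} \<le> card (nbrs E v)" by (rule card_mono[OF fin assms(2)])
  moreover have "card {a, b, c} = 3" using assms(3) by simp
  moreover have "even (card (nbrs E v))" "card (nbrs E v) \<le> 4"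
    using assms(1) by (auto simp: even_graph_def)
  ultimately have "card (nbrs E v) = 4" by presburger
  then have "card (nbrs E v - {a, b, c}) = 1"
    using \<open>card {a, b, c} = 3\<close> assms(2) fin by (simp add: card_Diff_subset del: card_Diff_insert)
  then obtain d where d: "nbrs E v - {a, b, c} = {d}" by (auto simp: card_1_singleton_iff)
  then have eq: "nbrs E v = {a, b, c, d}" using assms(2) by blast
  moreover have "d \<notin> {a, b, c}" using d by blast
  ultimately show ?thesis using assms(3) nbrs_irrefl[OF assms(1), of v] by (intro that[of d]) auto
qed

text \<open>Reduces adjacency at a vertex with a listed neighbourhood to equalities between names;
  the explicit case checks below are settled this way.\<close>

lemma edge_iff:
  assumes "nbrs E u = N"
  shows "{u, x} \<in> E \<longleftrightarrow> x \<in> N" "{x, u} \<in> E \<longleftrightarrow> x \<in> N"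
  using assms by (auto simp: nbrs_def insert_commute)

lemma nbrs_empty [simp]: "nbrs {} v = {}"
  by (simp add: nbrs_def)

lemma nbrs_insert:
  "nbrs (insert {x, y} S) v = (if v = x then {y} else if v = y then {x} else {}) \<union> nbrs S v"
  by (auto simp: nbrs_def doubleton_eq_iff)

text \<open>At the start of a longest path, evenness gives a neighbour other than the second vertex.
  By maximality it lies on the path, and the segment up to it closes to a circuit.\<close>

lemma exists_circuit:
  assumes "even_graph E" "E \<noteq> {}"
  obtains C where "is_circuit C" "C \<subseteq> E"
proof -
  define P where "P vs \<longleftrightarrow> distinct vs \<and> 2 \<le> length vs \<and> path_edges vs \<subseteq> E" for vs
  have fin: "finite (\<Union>E)" by (rule finite_Union_even_graph[OF assms(1)])
  have bound: "length vs \<le> card (\<Union>E)" if "P vs" for vs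
  proof -
    have "set vs = \<Union>(path_edges vs)" using that by (simp add: P_def Union_path_edges)
    then have "set vs \<subseteq> \<Union>E" using that by (auto simp: P_def)
    then show ?thesis using that card_mono[OF fin] by (metis P_def distinct_card)
  qed
  obtain e where "e \<in> E" using assms(2) by blast
  then have "card e = 2" using assms(1) by (simp add: even_graph_def)
  then obtain x0 y0 where "e = {x0, y0}" "x0 \<noteq> y0" by (auto simp: card_2_iff)
  then have "P [x0, y0]" using \<open>e \<in> E\<close> by (simp add: P_def)
  then obtain vs where vs: "P vs" and max: "\<And>ws. P ws \<Longrightarrow> length ws \<le> length vs"
    using ex_has_greatest_nat[of P "[x0, y0]" length "Suc (card (\<Union>E))"] bound
    by (metis le_imp_less_Suc)
  obtain x y xs where xy: "vs = x # y # xs"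
    using vs by (auto simp: P_def numeral_2_eq_2 Suc_le_length_iff)
  have "y \<in> nbrs E x" using vs by (simp add: xy P_def nbrs_def)
  moreover have "even (card (nbrs E x))" using assms(1) by (simp add: even_graph_def)
  ultimately have "nbrs E x \<noteq> {y}" by auto
  then obtain z where z: "z \<in> nbrs E x" "z \<noteq> y" using \<open>y \<in> nbrs E x\<close> by blast
  have "z \<noteq> x" using z nbrs_irrefl[OF assms(1)] by metis
  have "z \<in> set vs"
  proof (rule ccontr)
    assume "z \<notin> set vs"
    then have "P (z # vs)" using vs z by (simp add: xy P_def nbrs_def insert_commute)
    then show False using max[of "z # vs"] by simp
  qed
  then obtain as bs where ab: "xs = (as @ [z]) @ bs"
    using \<open>z \<noteq> x\<close> z(2) by (auto simp: xy in_set_conv_decomp)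
  let ?ws = "x # y # as @ [z]"
  have ws: "vs = ?ws @ bs" using xy ab by simp
  have "path_edges ?ws \<subseteq> E"
    using path_edges_append_subset[of ?ws bs] vs unfolding ws[symmetric] P_def by blast
  then have "cycle_edges ?ws \<subseteq> E" using z by (simp add: cycle_edges_eq nbrs_def insert_commute)
  moreover have "distinct ?ws" using vs unfolding ws P_def by simp
  moreover have "3 \<le> length ?ws" by simp
  ultimately show ?thesis using that[of "cycle_edges ?ws"] unfolding is_circuit_def by blast
qed

lemma half_sum_le:
  assumes "1 \<le> a" "1 \<le> b" "1 \<le> (c :: nat)"
  shows "(a - 1) div 2 + (b - 1) div 2 + (c - 1) div 2 \<le> (a + b + c - 3) div 2"
proof -
  obtain i j k where "a = Suc i" "b = Suc j" "c = Suc k"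
    using assms by (metis Suc_le_D One_nat_def)
  moreover have "i div 2 + j div 2 + k div 2 \<le> (i + j + k) div 2" by linarith
  ultimately show ?thesis by simp
qed

subsection \<open>Reductions\<close>

text \<open>The bound of the conjecture of Hajos, with \<open>\<Union>E\<close> as vertex set. For
  the empty graph truncated subtraction makes it 0.\<close>

definition hajos_bounded :: "'a set set \<Rightarrow> bool" where
  "hajos_bounded E \<longleftrightarrow> decomposes E ((card (\<Union>E) - 1) div 2)"

text \<open>Carries the induction hypothesis. Edges are counted because deleting a circuit and
  suppressing a vertex both lower their number.\<close>

locale smaller_bounded =
  fixes E :: "'a set set"
  assumes even_graph: "even_graph E"
    and smaller: "\<And>F :: 'a set set. even_graph F \<Longrightarrow> card F < card E \<Longrightarrow> hajos_bounded F"
begin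

lemma finite_E: "finite E"
  using even_graph by (simp add: even_graph_def)

lemma finite_vertices: "finite (\<Union>E)"
  by (rule finite_Union_even_graph[OF even_graph])

text \<open>The induction hypothesis on three parts subtracts 1 three times. \<open>W\<close> may
  exceed \<open>\<Union>F\<close> because \<open>x\<close>, \<open>y\<close> or \<open>z\<close> can
  be isolated in \<open>F\<close> and must still be counted.\<close>

lemma three_components:
  assumes F: "even_graph F" "F \<subset> E"
    and sep: "\<not> connected_in F x y" "\<not> connected_in F x z" "\<not> connected_in F y z"
    and W: "finite W" "\<Union>F \<subseteq> W" "{x, y, z} \<subseteq> W"
  shows "decomposes F ((card W - 3) div 2)"
proof -
  define K where "K v = {t. connected_in F v t}" for v
  \<comment> \<open>The third part holds \<open>z\<close> and every component other than those of
    \<open>x\<close> and \<open>y\<close>.\<close>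
  define L where "L = - (K x \<union> K y)"
  define R where "R M = {e \<in> F. e \<subseteq> M}" for M
  have closed: "component_closed F (K x)" "component_closed F (K y)" "component_closed F L"
    unfolding K_def L_def by (intro component_closed_Compl_Un component_closed_connected)+
  have disj: "K x \<inter> K y = {}"
    using sep(1) connected_in_trans connected_in_sym unfolding K_def by fast
  have ne: "x \<in> W \<inter> K x" "y \<in> W \<inter> K y" "z \<in> W \<inter> L"
    using W(3) sep connected_in_refl by (auto simp: K_def L_def)
  have dec: "decomposes (R M) ((card (W \<inter> M) - 1) div 2)" if "component_closed F M" for M
  proof -
    have "even_graph (R M)" unfolding R_def by (rule even_graph_restrict[OF F(1) that])
    moreover have "card (R M) < card E"
      using F(2) by (intro psubset_card_mono[OF finite_E]) (auto simp: R_def)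
    ultimately have "hajos_bounded (R M)" by (rule smaller)
    moreover have "card (\<Union>(R M)) \<le> card (W \<inter> M)"
      using W(1,2) by (intro card_mono) (auto simp: R_def)
    ultimately show ?thesis
      unfolding hajos_bounded_def by (rule_tac decomposes_mono) (auto intro: div_le_mono)
  qed
  have nonempty: "e \<noteq> {}" if "e \<in> F" for e
    using that F(1) by (auto simp: even_graph_def)
  have "R (K x) \<inter> R (K y) = {}" "(R (K x) \<union> R (K y)) \<inter> R L = {}"
    using disj nonempty unfolding R_def L_def by blast+
  moreover have "F = (R (K x) \<union> R (K y)) \<union> R L"
    using component_closed_edge[OF F(1) closed(1)] component_closed_edge[OF F(1) closed(2)]
    unfolding R_def L_def by blast
  ultimately have sum: "decomposes F ((card (W \<inter> K x) - 1) div 2 + (card (W \<inter> K y) - 1) div 2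
      + (card (W \<inter> L) - 1) div 2)"
    using decomposes_Un[OF decomposes_Un[OF dec[OF closed(1)] dec[OF closed(2)]] dec[OF closed(3)]]
    by simp
  have "card W = card (W \<inter> K x) + card (W \<inter> K y) + card (W \<inter> L)"
  proof -
    have "W = (W \<inter> K x \<union> W \<inter> K y) \<union> W \<inter> L" unfolding L_def by blast
    moreover have "card ((W \<inter> K x \<union> W \<inter> K y) \<union> W \<inter> L) = card (W \<inter> K x \<union> W \<inter> K y) + card (W \<inter> L)"
      using W(1) unfolding L_def by (intro card_Un_disjoint) auto
    moreover have "card (W \<inter> K x \<union> W \<inter> K y) = card (W \<inter> K x) + card (W \<inter> K y)"
      using W(1) disj by (intro card_Un_disjoint) auto
    ultimately show ?thesis by simp
  qed
  \<comment> \<open>Each part contains one of the three vertices, so no subtraction of 1 is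
    truncated.\<close>
  moreover have "1 \<le> card (W \<inter> K x)" "1 \<le> card (W \<inter> K y)" "1 \<le> card (W \<inter> L)"
    using ne W(1) by (auto simp: Suc_le_eq card_gt_0_iff)
  ultimately show ?thesis using decomposes_mono[OF sum half_sum_le] by simp
qed

text \<open>Losing the vertex \<open>v\<close> improves the bound by half a circuit. The suppression
  itself drops an edge, so \<open>F\<close> may have as many edges as \<open>E\<close>.\<close>

lemma suppress_one:
  fixes F :: "'a set set"
  assumes "even_graph F" "card F \<le> card E" "nbrs F v = {a, b}" "a \<noteq> b" "{a, b} \<notin> F"
  shows "decomposes F ((card (\<Union>F) - 2) div 2)"
proof -
  note suppr = assms(1,3-5)
  have "hajos_bounded (suppress F v a b)"
    using card_suppress[OF suppr] assms(2) by (intro smaller even_graph_suppress[OF suppr]) simp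
  then have "decomposes (suppress F v a b) ((card (\<Union>(suppress F v a b)) - 1) div 2)"
    by (simp add: hajos_bounded_def)
  moreover have "(card (\<Union>(suppress F v a b)) - 1) div 2 \<le> (card (\<Union>F) - 2) div 2"
    using card_Union_suppress[OF suppr] by (intro div_le_mono) linarith
  ultimately show ?thesis by (intro decomposes_suppress[OF suppr]) (rule decomposes_mono)
qed

text \<open>Two suppressions save a whole circuit, which later pays for the one deleted from
  \<open>E\<close>.\<close>

lemma suppress_again:
  fixes F :: "'a set set"
  assumes "even_graph F" "card F \<le> card E" "nbrs F u = {a, b}" "a \<noteq> b" "{a, b} \<notin> F"
    and "nbrs (suppress F u a b) w = {c, d}" "c \<noteq> d" "{c, d} \<notin> suppress F u a b"
  shows "decomposes F ((card (\<Union>F) - 3) div 2)"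
proof -
  note suppr = assms(1,3-5)
  have "decomposes (suppress F u a b) ((card (\<Union>(suppress F u a b)) - 2) div 2)"
    using assms(2) card_suppress[OF suppr]
    by (intro suppress_one[OF even_graph_suppress[OF suppr] _ assms(6-8)]) simp
  moreover have "(card (\<Union>(suppress F u a b)) - 2) div 2 \<le> (card (\<Union>F) - 3) div 2"
    using card_Union_suppress[OF suppr] by (intro div_le_mono) linarith
  ultimately show ?thesis by (intro decomposes_suppress[OF suppr]) (rule decomposes_mono)
qed

lemma bounded_by_removing:
  assumes "is_circuit C" "C \<subseteq> E" "decomposes (E - C) ((card (\<Union>E) - 3) div 2)"
  shows "hajos_bounded E"
proof -
  \<comment> \<open>This keeps \<open>card (\<Union>E) - 3\<close> from being truncated, so one more
    circuit gives exactly the desired bound.\<close>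
  have "3 \<le> card (\<Union>E)"
    using card_Union_circuit[OF assms(1)] card_mono[OF finite_vertices Union_mono[OF assms(2)]]
    by simp
  then have "Suc ((card (\<Union>E) - 3) div 2) = (card (\<Union>E) - 1) div 2" by linarith
  then show ?thesis using decomposes_Diff[OF assms] by (simp add: hajos_bounded_def)
qed

text \<open>
  In the second conclusion \<open>b - u - w - d\<close> is a path of the remaining graph, both of whose inner
  vertices are suppressed.
\<close>

lemma
  assumes vs: "distinct vs" "3 \<le> length vs" "cycle_edges vs \<subseteq> E"
    and u: "nbrs E u - nbrs (cycle_edges vs) u = {a, b}" "a \<noteq> b" "{a, b} \<notin> E - cycle_edges vs"
    and w: "nbrs E w - nbrs (cycle_edges vs) w = {c, d}" "c \<noteq> d"
  shows remove_circuit_suppress_pair: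
      "\<lbrakk>u \<noteq> w; u \<noteq> c; u \<noteq> d; {c, d} \<notin> E - cycle_edges vs; {a, b} \<noteq> {c, d}\<rbrakk> \<Longrightarrow> hajos_bounded E"
    and remove_circuit_suppress_chain:
      "\<lbrakk>a = w; c = u; b \<noteq> d; {b, d} \<notin> E - cycle_edges vs\<rbrakk> \<Longrightarrow> hajos_bounded E"
proof -
  let ?C = "cycle_edges vs" and ?F = "E - cycle_edges vs"
  have C: "is_circuit ?C" using vs by (auto simp: is_circuit_def)
  have F: "even_graph ?F" by (rule even_graph_Diff_circuit[OF even_graph C vs(3)])
  have cF: "card ?F \<le> card E" by (rule card_mono[OF finite_E]) blast
  have nu: "nbrs ?F u = {a, b}" and nw: "nbrs ?F w = {c, d}" using u w by (simp_all add: nbrs_Diff)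
  have "card (\<Union>?F) \<le> card (\<Union>E)" by (rule card_mono[OF finite_vertices]) blast
  then have hajos_bounded: "hajos_bounded E" if "decomposes ?F ((card (\<Union>?F) - 3) div 2)"
    by (intro bounded_by_removing[OF C vs(3)] decomposes_mono[OF that]) linarith
  note nsup = nbrs_suppress[OF F nu u(2,3)]
  note sup = suppress_again[OF F cF nu u(2,3) _ w(2)]
  show "hajos_bounded E" if "u \<noteq> w" "u \<noteq> c" "u \<noteq> d" "{c, d} \<notin> ?F" "{a, b} \<noteq> {c, d}"
  proof -
    \<comment> \<open>\<open>w\<close> is not adjacent to \<open>u\<close>, so the first suppression
      leaves its neighbourhood alone. As the pairs differ, the new edge is not \<open>{c, d}\<close>
      either.\<close>
    have "w \<noteq> a" "w \<noteq> b" using nbrs_sym[of u ?F w] nu nw that by auto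
    then have "nbrs (suppress ?F u a b) w = {c, d}" using nsup[of w] that nw by simp
    moreover have "{c, d} \<notin> suppress ?F u a b" using that unfolding suppress_def by simp
    ultimately show ?thesis using hajos_bounded sup by blast
  qed
  show "hajos_bounded E" if "a = w" "c = u" "b \<noteq> d" "{b, d} \<notin> ?F"
  proof -
    have irr: "w \<notin> nbrs ?F w" by (rule nbrs_irrefl[OF F])
    have "w \<noteq> u" "d \<noteq> w" using irr nw that by auto
    \<comment> \<open>Suppressing \<open>u\<close> hands its other neighbour \<open>b\<close> to
      \<open>w\<close>, which then lies between \<open>b\<close> and \<open>d\<close>.\<close>
    then have "nbrs (suppress ?F u a b) w = {b, d}" using nsup[of w] that nw w(2)
      by (simp add: insert_Diff_if)
    moreover have "{b, d} \<notin> suppress ?F u a b"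
      using that \<open>d \<noteq> w\<close> u(2) unfolding suppress_def by (simp add: doubleton_eq_iff)
    ultimately show ?thesis using hajos_bounded suppress_again[OF F cF nu u(2,3)] that by blast
  qed
qed

end

subsection \<open>Graphs in which no edge lies in two triangles\<close>

text \<open>Two triangles on a common edge are excluded as a subgraph, not just as an induced one;
  so a complete graph on four vertices is excluded too.\<close>

definition diamond_free :: "'a set set \<Rightarrow> bool" where
  "diamond_free E \<longleftrightarrow> (\<forall>u w p q. w \<in> nbrs E u \<longrightarrow> {p, q} \<subseteq> nbrs E u \<inter> nbrs E w \<longrightarrow> p = q)"

context smaller_bounded
begin

text \<open>Both ends keep two neighbours. If these pairs agreed, the edge \<open>{u, w}\<close>
  would lie in two triangles; so the two suppressions do not interfere.\<close>

lemma remove_circuit_through_edge: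
  assumes "diamond_free E" and vs: "distinct vs" "3 \<le> length vs" "cycle_edges vs \<subseteq> E"
    and uw: "{u, w} \<in> cycle_edges vs"
    and deg: "card (nbrs E u) = 4" "card (nbrs E w) = 4"
    and nonadj: "\<And>a b. {a, b} \<subseteq> nbrs E u - nbrs (cycle_edges vs) u \<Longrightarrow> a \<noteq> b \<Longrightarrow> {a, b} \<notin> E"
      "\<And>a b. {a, b} \<subseteq> nbrs E w - nbrs (cycle_edges vs) w \<Longrightarrow> a \<noteq> b \<Longrightarrow> {a, b} \<notin> E"
  shows "hajos_bounded E"
proof -
  let ?C = "cycle_edges vs"
  have C: "is_circuit ?C" using vs by (auto simp: is_circuit_def)
  have wu: "w \<in> nbrs ?C u" "u \<in> nbrs ?C w" using uw by (auto simp: nbrs_def insert_commute)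
  have "card (nbrs E x - nbrs ?C x) = 2" if "x \<in> \<Union>?C" "card (nbrs E x) = 4" for x
    using that card_nbrs_circuit[OF C, of x] nbrs_mono[OF vs(3), of x]
      finite_subset[OF nbrs_mono[OF vs(3)] finite_nbrs[OF even_graph]]
    by (simp add: card_Diff_subset del: Union_iff)
  then have "card (nbrs E u - nbrs ?C u) = 2" "card (nbrs E w - nbrs ?C w) = 2"
    using uw deg by blast+
  then obtain a b c d where
    ab: "nbrs E u - nbrs ?C u = {a, b}" "a \<noteq> b" and cd: "nbrs E w - nbrs ?C w = {c, d}" "c \<noteq> d"
    unfolding card_2_iff by blast
  have wE: "w \<in> nbrs E u" using wu nbrs_mono[OF vs(3)] by blast
  show ?thesis
  proof (rule remove_circuit_suppress_pair[OF vs ab _ cd])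
    show "{a, b} \<notin> E - ?C" using nonadj(1)[of a b] ab by simp
    show "{c, d} \<notin> E - ?C" using nonadj(2)[of c d] cd by simp
    show "u \<noteq> w" using wE nbrs_irrefl[OF even_graph, of u] by blast
    show "u \<noteq> c" "u \<noteq> d" using cd(1) wu(2) by blast+
    show "{a, b} \<noteq> {c, d}"
    proof
      assume "{a, b} = {c, d}"
      then have "{a, b} \<subseteq> nbrs E u \<inter> nbrs E w" using ab(1) cd(1) by blast
      then show False using assms(1) wE ab(2) unfolding diamond_free_def by blast
    qed
  qed
qed

text \<open>A vertex of degree two can be suppressed at once. Otherwise all degrees are 4, and any
  edge of any circuit will do.\<close>

lemma bounded_triangle_free:
  assumes "E \<noteq> {}" and tf: "\<And>u w. w \<in> nbrs E u \<Longrightarrow> nbrs E u \<inter> nbrs E w = {}"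
  shows "hajos_bounded E"
proof (cases "\<exists>v. card (nbrs E v) = 2")
  case True
  then obtain v a b where ab: "nbrs E v = {a, b}" "a \<noteq> b" by (auto simp: card_2_iff)
  then have "{a, b} \<notin> E" using tf[of a v] by (auto simp: nbrs_def)
  then have "decomposes E ((card (\<Union>E) - 2) div 2)"
    using suppress_one[OF even_graph _ ab] by simp
  then show ?thesis unfolding hajos_bounded_def by (rule decomposes_mono) (simp add: div_le_mono)
next
  case False
  have deg: "card (nbrs E v) = 4" if "v \<in> \<Union>E" for v
  proof -
    have "nbrs E v \<noteq> {}" using that Union_conv_nbrs[OF even_graph] by blast
    then have "card (nbrs E v) \<noteq> 0" using finite_nbrs[OF even_graph] by simp
    moreover have "card (nbrs E v) \<noteq> 2" using False by blast
    moreover have "even (card (nbrs E v))" "card (nbrs E v) \<le> 4"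
      using even_graph by (auto simp: even_graph_def)
    ultimately show ?thesis by presburger
  qed
  obtain C where "is_circuit C" "C \<subseteq> E" using exists_circuit[OF even_graph assms(1)] .
  then obtain vs where vs: "distinct vs" "3 \<le> length vs" "cycle_edges vs \<subseteq> E"
    by (auto simp: is_circuit_def)
  then have "vs \<noteq> []" by auto
  then have e: "{last vs, hd vs} \<in> cycle_edges vs" by (simp add: cycle_edges_eq)
  have "{a, b} \<notin> E" if "{a, b} \<subseteq> nbrs E v" for a b v
    using that tf[of a v] by (auto simp: nbrs_def)
  moreover have "diamond_free E" unfolding diamond_free_def using tf by blast
  moreover have "last vs \<in> \<Union>E" "hd vs \<in> \<Union>E" using e vs(3) by blast+
  ultimately show ?thesis
    using deg by (intro remove_circuit_through_edge[OF _ vs e]) blast+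
qed

text \<open>The path is closed by \<open>{u, w}\<close>. It avoids the edges to \<open>c\<close>, so
  \<open>c\<close> stays a neighbour of both ends and forces their degree to be 4.\<close>

lemma bounded_triangle_connected:
  assumes df: "diamond_free E"
    and T: "distinct [u, w, c]" "{u, w} \<in> E" "{u, c} \<in> E" "{w, c} \<in> E"
    and conn: "connected_in (E - {{u, w}, {u, c}, {w, c}}) u w"
  shows "hajos_bounded E"
proof -
  obtain vs where vs: "distinct vs" "vs \<noteq> []" "hd vs = u" "last vs = w"
    "path_edges vs \<subseteq> E - {{u, w}, {u, c}, {w, c}}"
    using connected_in_path[OF conn] .
  \<comment> \<open>A path with two vertices would be the removed edge
    \<open>{u, w}\<close>.\<close>
  have len: "3 \<le> length vs"
  proof (rule ccontr)
    assume "\<not> 3 \<le> length vs"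
    moreover have "length vs \<noteq> 0" using vs(2) by simp
    ultimately have "length vs = 1 \<or> length vs = 2" by linarith
    moreover have "length vs \<noteq> 1"
      using vs(3,4) T(1) by (auto simp: length_Suc_conv)
    ultimately have "vs = [u, w]" using vs(3,4) by (auto simp: numeral_2_eq_2 length_Suc_conv)
    then show False using vs(5) by simp
  qed
  let ?C = "cycle_edges vs"
  have Ceq: "?C = insert {w, u} (path_edges vs)" using vs by (simp add: cycle_edges_eq)
  have CE: "?C \<subseteq> E" using vs(5) T(2) by (auto simp: Ceq insert_commute)
  have C: "is_circuit ?C" using vs(1) len by (auto simp: is_circuit_def)
  have wu: "w \<in> nbrs ?C u" "u \<in> nbrs ?C w" by (auto simp: Ceq nbrs_def insert_commute)
  have "{u, c} \<notin> ?C" "{w, c} \<notin> ?C" using vs(5) T(1) by (auto simp: Ceq doubleton_eq_iff)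
  then have c: "c \<in> nbrs E u - nbrs ?C u" "c \<in> nbrs E w - nbrs ?C w"
    using T by (auto simp: nbrs_def)
  have deg: "card (nbrs E x) = 4" if "y \<in> nbrs ?C x" "c \<in> nbrs E x - nbrs ?C x" for x y
  proof -
    have "x \<in> \<Union>?C" using that(1) unfolding nbrs_def by blast
    then have "card (nbrs ?C x) = 2" using card_nbrs_circuit[OF C, of x] by simp
    moreover have "card (nbrs ?C x) < card (nbrs E x)"
      using that(2) nbrs_mono[OF CE, of x] finite_nbrs[OF even_graph]
      by (intro psubset_card_mono) auto
    moreover have "even (card (nbrs E x))" "card (nbrs E x) \<le> 4"
      using even_graph by (auto simp: even_graph_def)
    ultimately show ?thesis by presburger
  qed
  have nonadj: "{a, b} \<notin> E"
    if ab: "{a, b} \<subseteq> nbrs E x - nbrs ?C x" "a \<noteq> b" and xy: "y \<in> nbrs ?C x"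
      "c \<in> nbrs E x - nbrs ?C x" "c \<in> nbrs E y" for a b x y
  proof
    assume "{a, b} \<in> E"
    have "card (nbrs E x - nbrs ?C x) = 2"
    proof -
      have "x \<in> \<Union>?C" using xy(1) unfolding nbrs_def by blast
      then show ?thesis using deg[OF xy(1,2)] card_nbrs_circuit[OF C, of x] nbrs_mono[OF CE, of x]
          finite_subset[OF nbrs_mono[OF CE] finite_nbrs[OF even_graph]]
        by (simp add: card_Diff_subset del: Union_iff)
    qed
    then have "{a, b} = nbrs E x - nbrs ?C x"
      using ab finite_nbrs[OF even_graph] by (intro card_subset_eq) auto
    then have "c = a \<or> c = b" using xy(2) by blast
    \<comment> \<open>If the leftover neighbours \<open>c\<close> and \<open>z\<close> of
      \<open>x\<close> were adjacent, the edge \<open>{c, x}\<close> would lie in triangles with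
      both \<open>y\<close> and \<open>z\<close>.\<close>
    then obtain z where z: "z \<in> nbrs E x - nbrs ?C x" "z \<noteq> c" "{c, z} \<in> E"
      using ab \<open>{a, b} \<in> E\<close> by (metis insert_subset insert_commute)
    have "{y, z} \<subseteq> nbrs E c \<inter> nbrs E x"
      using z xy nbrs_mono[OF CE, of x] nbrs_sym[of c E y] by (auto simp: nbrs_def)
    moreover have "x \<in> nbrs E c" using xy(2) nbrs_sym[of c E x] by blast
    ultimately have "y = z" using df unfolding diamond_free_def by blast
    then show False using z xy by blast
  qed
  have cE: "c \<in> nbrs E u" "c \<in> nbrs E w" using c by blast+
  show ?thesis
  proof (rule remove_circuit_through_edge[OF df vs(1) len CE])
    show "{u, w} \<in> ?C" by (simp add: Ceq insert_commute)
    show "card (nbrs E u) = 4" "card (nbrs E w) = 4"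
      by (rule deg[OF wu(1) c(1)], rule deg[OF wu(2) c(2)])
    show "{a, b} \<notin> E" if "{a, b} \<subseteq> nbrs E u - nbrs ?C u" "a \<noteq> b" for a b
      by (rule nonadj[OF that wu(1) c(1) cE(2)])
    show "{a, b} \<notin> E" if "{a, b} \<subseteq> nbrs E w - nbrs ?C w" "a \<noteq> b" for a b
      by (rule nonadj[OF that wu(2) c(2) cE(1)])
  qed
qed

lemma bounded_triangle:
  assumes df: "diamond_free E"
    and T: "distinct [u, w, c]" "{u, w} \<in> E" "{u, c} \<in> E" "{w, c} \<in> E"
  shows "hajos_bounded E"
proof -
  define F where "F = E - {{u, w}, {u, c}, {w, c}}"
  consider "connected_in F u w" | "connected_in F u c" | "connected_in F w c"
    | "\<not> connected_in F u w" "\<not> connected_in F u c" "\<not> connected_in F w c" by blast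
  then show ?thesis
  proof cases
    case 1
    then show ?thesis using bounded_triangle_connected[OF df T] by (simp add: F_def)
  next
    case 2
    then show ?thesis using bounded_triangle_connected[OF df, of u c w] T
      by (auto simp: F_def insert_commute)
  next
    case 3
    then show ?thesis using bounded_triangle_connected[OF df, of w c u] T
      by (auto simp: F_def insert_commute)
  next
    case 4
    have C: "cycle_edges [u, w, c] = {{u, w}, {u, c}, {w, c}}"
      by (simp add: cycle_edges_eq insert_commute)
    have circ: "is_circuit (cycle_edges [u, w, c])"
      unfolding is_circuit_def using T(1) by (intro exI[of _ "[u, w, c]"]) simp
    have sub: "cycle_edges [u, w, c] \<subseteq> E" unfolding C using T by simp
    have F: "F = E - cycle_edges [u, w, c]" by (simp only: F_def C)
    \<comment> \<open>All of \<open>\<Union>E\<close> is used as \<open>W\<close>, since a corner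
      may be isolated in \<open>F\<close>.\<close>
    have "decomposes F ((card (\<Union>E) - 3) div 2)"
    proof (rule three_components[OF _ _ 4 finite_vertices])
      show "even_graph F" unfolding F by (rule even_graph_Diff_circuit[OF even_graph circ sub])
      show "F \<subset> E" "\<Union>F \<subseteq> \<Union>E" "{u, w, c} \<subseteq> \<Union>E" unfolding F_def using T by blast+
    qed
    then show ?thesis unfolding F by (rule bounded_by_removing[OF circ sub])
  qed
qed

end

subsection \<open>An edge in two triangles\<close>

context smaller_bounded
begin

section \<open>Adjacent vertices with exactly two common neighbours\<close>

context
  fixes u w p q r s :: 'a
  assumes nu: "nbrs E u = {w, p, q, r}" and nw: "nbrs E w = {u, p, q, s}"
    and dist: "distinct [u, w, p, q, r, s]"
begin

text \<open>Deleting the triangle \<open>u w p\<close> leaves \<open>u\<close> between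
  \<open>q\<close>, \<open>r\<close> and \<open>w\<close> between \<open>q\<close>,
  \<open>s\<close>.\<close>

lemma diamond_tip_nonadjacent:
  assumes "{q, r} \<notin> E" "{q, s} \<notin> E"
  shows "hajos_bounded E"
  \<comment> \<open>The reversed list supplies every inequality in its other orientation, here and
    in the later checks.\<close>
  by (rule remove_circuit_suppress_pair[of "[u, w, p]" u q r w q s])
    (use dist distinct_rev[THEN iffD2, OF dist] assms in \<open>simp_all add: cycle_edges_eq nbrs_insert nu nw edge_iff[OF nu] edge_iff[OF nw]
      insert_Diff_if doubleton_eq_iff\<close>)

text \<open>Deleting the four-cycle \<open>u p w q\<close> leaves the path
  \<open>r - u - w - s\<close>, which is contracted to one edge.\<close>

lemma diamond_outer_nonadjacent:
  assumes "{r, s} \<notin> E"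
  shows "hajos_bounded E"
  by (rule remove_circuit_suppress_chain[of "[u, p, w, q]" u w r w u s])
    (use dist distinct_rev[THEN iffD2, OF dist] assms in \<open>simp_all add: cycle_edges_eq nbrs_insert nu nw edge_iff[OF nu] edge_iff[OF nw]
      insert_Diff_if doubleton_eq_iff\<close>)

text \<open>The neighbourhoods of \<open>u\<close>, \<open>w\<close> and \<open>r\<close> are now
  known; the case analysis is on the fourth neighbours \<open>p'\<close> of \<open>p\<close> and
  \<open>q'\<close> of \<open>q\<close>.\<close>

lemma diamond_outer_wheel:
  assumes "{r, s} \<in> E" "{r, p} \<in> E" "{r, q} \<in> E"
  shows "hajos_bounded E"
proof -
  have "{u, p, q} \<subseteq> nbrs E r" "s \<in> nbrs E r"
    using assms nu by (auto simp: nbrs_def insert_commute)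
  then obtain t where "nbrs E r = {u, p, q, t}" using fourth_nbr[OF even_graph, of u p q r] dist
    by auto
  then have nr: "nbrs E r = {u, p, q, s}" using \<open>s \<in> nbrs E r\<close> dist by auto
  have "{u, w, r} \<subseteq> nbrs E p" "{u, w, r} \<subseteq> nbrs E q"
    using assms nu nw by (auto simp: nbrs_def insert_commute)
  then obtain p' q' where np: "nbrs E p = {u, w, r, p'}" "distinct [p, u, w, r, p']"
    and nq: "nbrs E q = {u, w, r, q'}" "distinct [q, u, w, r, q']"
    using fourth_nbr[OF even_graph, of u w r p] fourth_nbr[OF even_graph, of u w r q] dist
    by (metis distinct_length_2_or_more distinct_singleton)
  note facts = cycle_edges_eq nbrs_insert nu nw nr np(1) nq(1) edge_iff[OF nu] edge_iff[OF nw]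
    edge_iff[OF nr] edge_iff[OF np(1)] edge_iff[OF nq(1)] insert_Diff_if doubleton_eq_iff
  show ?thesis
  proof (cases "p' = q")
    case True
    then have "q' = p" using nq(1) np(1) edge_iff[OF np(1), of q] edge_iff(1)[OF nq(1), of p] dist
      by (auto simp: insert_commute)
    \<comment> \<open>\<open>r\<close> keeps \<open>p\<close>, \<open>q\<close> and \<open>u\<close>
      keeps \<open>w\<close>, \<open>q\<close>. Both pairs are edges of the deleted circuit and
      hence nonadjacent afterwards.\<close>
    with True show ?thesis
      by (intro remove_circuit_suppress_pair[of "[w, s, r, u, p, q]" r p q u w q])
        (use dist distinct_rev[THEN iffD2, OF dist] in \<open>simp_all add: facts\<close>)
  next
    case False
    then have pq: "p' \<noteq> q" "q' \<noteq> p"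
      using edge_iff(2)[OF np(1), of q] edge_iff(1)[OF nq(1), of p] dist by (auto simp: insert_commute)
    \<comment> \<open>The path \<open>q - w - p - p'\<close> remains; its ends are nonadjacent
      because \<open>p'\<close> is not the fourth neighbour of \<open>q\<close>.\<close>
    have p_chain: ?thesis if "p' \<noteq> s" "q' \<noteq> p'"
      by (rule remove_circuit_suppress_chain[of "[w, s, r, p, u]" w p q p w p'])
        (use dist distinct_rev[THEN iffD2, OF dist] np(2) distinct_rev[THEN iffD2, OF np(2)] nq(2) distinct_rev[THEN iffD2, OF nq(2)] pq that in \<open>simp_all add: facts\<close>)
    have q_chain: ?thesis if "q' \<noteq> s" "q' \<noteq> p'"
      by (rule remove_circuit_suppress_chain[of "[w, s, r, q, u]" w q p q w q'])
        (use dist distinct_rev[THEN iffD2, OF dist] np(2) distinct_rev[THEN iffD2, OF np(2)] nq(2) distinct_rev[THEN iffD2, OF nq(2)] pq that in \<open>simp_all add: facts insert_commute\<close>)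
    \<comment> \<open>If \<open>p'\<close> and \<open>q'\<close> differ, at most one of them is
      \<open>s\<close>, and the other gives a chain.\<close>
    consider "p' = q'" "p' \<noteq> s" | "p' = s" "q' = s" | "p' \<noteq> s" "q' \<noteq> p'" | "q' \<noteq> s" "q' \<noteq> p'"
      by blast
    then show ?thesis
    proof cases
      case 1
      \<comment> \<open>\<open>w\<close> keeps \<open>u\<close>, \<open>q\<close> and
        \<open>p\<close> keeps \<open>u\<close>, \<open>r\<close>, again edges of the deleted
        circuit.\<close>
      then show ?thesis
        by (intro remove_circuit_suppress_pair[of "[s, w, p, p', q, u, r]" w u q p u r])
          (use dist distinct_rev[THEN iffD2, OF dist] np(2) distinct_rev[THEN iffD2, OF np(2)] nq(2) distinct_rev[THEN iffD2, OF nq(2)] pq in \<open>simp_all add: facts\<close>)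
    next
      case 2
      \<comment> \<open>\<open>u\<close> keeps \<open>p\<close>, \<open>r\<close> and
        \<open>w\<close> keeps \<open>q\<close>, \<open>s\<close>, both edges of the deleted
        circuit.\<close>
      then show ?thesis
        by (intro remove_circuit_suppress_pair[of "[u, w, p, r, s, q]" u p r w q s])
          (use dist distinct_rev[THEN iffD2, OF dist] np(2) distinct_rev[THEN iffD2, OF np(2)] nq(2) distinct_rev[THEN iffD2, OF nq(2)] pq in \<open>simp_all add: facts\<close>)
    qed (use p_chain q_chain in blast)+
  qed
qed

lemma diamond_outer_square:
  assumes "{r, s} \<in> E" "{q, r} \<in> E" "{p, s} \<in> E"
  shows "hajos_bounded E"
proof (cases "{p, q} \<in> E")
  case False
  have "{u, w, s} \<subseteq> nbrs E p" using assms nu nw by (auto simp: nbrs_def insert_commute)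
  then obtain p' where np: "nbrs E p = {u, w, s, p'}" "distinct [p, u, w, s, p']"
    using fourth_nbr[OF even_graph, of u w s p] dist by auto
  have "p' \<noteq> q" using False np(1) by (auto simp: nbrs_def)
  \<comment> \<open>\<open>u\<close> keeps \<open>w\<close>, \<open>q\<close>, whose edge is
    deleted. \<open>p\<close> keeps \<open>w\<close>, \<open>p'\<close>, and \<open>p'\<close> is
    not a neighbour of \<open>w\<close>.\<close>
  then show ?thesis
    by (intro remove_circuit_suppress_pair[of "[u, p, s, w, q, r]" u w q p w p'])
      (use dist distinct_rev[THEN iffD2, OF dist] np(2) distinct_rev[THEN iffD2, OF np(2)] assms in \<open>simp_all add: cycle_edges_eq nbrs_insert nu nw np(1) edge_iff[OF nu]
        edge_iff[OF nw] edge_iff[OF np(1)] insert_Diff_if doubleton_eq_iff insert_commute\<close>)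
next
  case True
  have "{u, w, r} \<subseteq> nbrs E q" "p \<in> nbrs E q"
    using assms True nu nw by (auto simp: nbrs_def insert_commute)
  then obtain t where "nbrs E q = {u, w, r, t}"
    using fourth_nbr[OF even_graph, of u w r q] dist by auto
  then have nq: "nbrs E q = {u, w, r, p}" using \<open>p \<in> nbrs E q\<close> dist by auto
  have "{u, w, s} \<subseteq> nbrs E p" "q \<in> nbrs E p"
    using assms True nu nw by (auto simp: nbrs_def insert_commute)
  then obtain t where "nbrs E p = {u, w, s, t}"
    using fourth_nbr[OF even_graph, of u w s p] dist by auto
  then have np: "nbrs E p = {u, w, s, q}" using \<open>q \<in> nbrs E p\<close> dist by auto
  have "{w, p, r} \<subseteq> nbrs E s" using assms nu nw by (auto simp: nbrs_def insert_commute)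
  then obtain s' where ns: "nbrs E s = {w, p, r, s'}" "distinct [s, w, p, r, s']"
    using fourth_nbr[OF even_graph, of w p r s] dist by auto
  have "s' \<noteq> u" "s' \<noteq> q"
    using nu nq ns(1) nbrs_sym[of s E u] nbrs_sym[of s E q] dist by auto
  \<comment> \<open>\<open>q\<close> keeps \<open>w\<close>, \<open>r\<close> and \<open>s\<close>
    keeps \<open>w\<close>, \<open>s'\<close>; neither \<open>r\<close> nor \<open>s'\<close> is a
    neighbour of \<open>w\<close>.\<close>
  then show ?thesis
    by (intro remove_circuit_suppress_pair[of "[r, u, q, p, s]" q w r s w s'])
      (use dist distinct_rev[THEN iffD2, OF dist] ns(2) distinct_rev[THEN iffD2, OF ns(2)] assms in \<open>simp_all add: cycle_edges_eq nbrs_insert nu nw np nq ns(1) edge_iff[OF nu]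
        edge_iff[OF nw] edge_iff[OF np] edge_iff[OF nq] edge_iff[OF ns(1)] insert_Diff_if
        doubleton_eq_iff insert_commute\<close>)
qed

end

text \<open>If \<open>r\<close>, \<open>s\<close> are adjacent and each of \<open>p\<close>,
  \<open>q\<close> is joined to one of them, then either \<open>r\<close> or \<open>s\<close> is
  joined to both, or the joins are crossed. Swapping \<open>p\<close> with \<open>q\<close>, or
  \<open>u\<close>, \<open>r\<close> with \<open>w\<close>, \<open>s\<close>, covers the symmetric
  cases.\<close>

lemma bounded_diamond_nontwin:
  assumes nu: "nbrs E u = {w, p, q, r}" and nw: "nbrs E w = {u, p, q, s}"
    and dist: "distinct [u, w, p, q, r, s]"
  shows "hajos_bounded E"
proof -
  have nu': "nbrs E u = {w, q, p, r}" and nw': "nbrs E w = {u, q, p, s}" using nu nw by auto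
  have dist': "distinct [u, w, q, p, r, s]" "distinct [w, u, p, q, s, r]" "distinct [w, u, q, p, s, r]"
    using dist by auto
  consider "{q, r} \<notin> E" "{q, s} \<notin> E" | "{p, r} \<notin> E" "{p, s} \<notin> E" | "{r, s} \<notin> E"
    | "{r, s} \<in> E" "{r, p} \<in> E" "{r, q} \<in> E" | "{s, r} \<in> E" "{s, p} \<in> E" "{s, q} \<in> E"
    | "{r, s} \<in> E" "{q, r} \<in> E" "{p, s} \<in> E" | "{r, s} \<in> E" "{p, r} \<in> E" "{q, s} \<in> E"
    by (metis insert_commute)
  then show ?thesis
  proof cases
    case 1
    then show ?thesis by (rule diamond_tip_nonadjacent[OF nu nw dist])
  next
    case 2
    then show ?thesis by (rule diamond_tip_nonadjacent[OF nu' nw' dist'(1)])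
  next
    case 3
    then show ?thesis by (rule diamond_outer_nonadjacent[OF nu nw dist])
  next
    case 4
    then show ?thesis by (rule diamond_outer_wheel[OF nu nw dist])
  next
    case 5
    then show ?thesis by (rule diamond_outer_wheel[OF nw nu dist'(2)])
  next
    case 6
    then show ?thesis by (rule diamond_outer_square[OF nu nw dist])
  next
    case 7
    then show ?thesis by (rule diamond_outer_square[OF nu' nw' dist'(1)])
  qed
qed

end

context smaller_bounded
begin

section \<open>Adjacent twins with three common neighbours\<close>

context
  fixes u w p q r :: 'a
  assumes nu: "nbrs E u = {w, p, q, r}" and nw: "nbrs E w = {u, p, q, r}"
    and dist: "distinct [u, w, p, q, r]"
begin

text \<open>The circuit runs through both edges, so the pairs \<open>q\<close>, \<open>r\<close> and
  \<open>p\<close>, \<open>q\<close> left at \<open>u\<close> and \<open>w\<close> become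
  nonadjacent.\<close>

lemma twins_two_edges:
  assumes "{p, q} \<in> E" "{q, r} \<in> E"
  shows "hajos_bounded E"
  by (rule remove_circuit_suppress_pair[of "[u, p, q, r, w]" u q r w p q])
    (use dist distinct_rev[THEN iffD2, OF dist] assms in \<open>simp_all add: cycle_edges_eq nbrs_insert
      nu nw edge_iff[OF nu] edge_iff[OF nw] insert_Diff_if doubleton_eq_iff\<close>)

text \<open>The four-cycle \<open>u p q w\<close> leaves \<open>u\<close> with \<open>q\<close>,
  \<open>r\<close> and \<open>w\<close> with \<open>p\<close>, \<open>r\<close>.\<close>

lemma twins_one_edge:
  assumes "{p, q} \<in> E" "{q, r} \<notin> E" "{p, r} \<notin> E"
  shows "hajos_bounded E"
  by (rule remove_circuit_suppress_pair[of "[u, p, q, w]" u q r w p r])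
    (use dist distinct_rev[THEN iffD2, OF dist] assms in \<open>simp_all add: cycle_edges_eq nbrs_insert
      nu nw edge_iff[OF nu] edge_iff[OF nw] insert_Diff_if doubleton_eq_iff\<close>)

text \<open>These are all seven edges at \<open>u\<close> or \<open>w\<close>, arranged as a
  triangle and a four-cycle.\<close>

abbreviation twin_edges :: "'a set set" where
  "twin_edges \<equiv> cycle_edges [u, w, p] \<union> cycle_edges [u, q, w, r]"

text \<open>The path avoids \<open>u\<close> and \<open>w\<close>, so it closes through
  \<open>w\<close> and \<open>u\<close> to a circuit leaving \<open>u\<close> with \<open>q\<close>,
  \<open>r\<close> and \<open>w\<close> with \<open>p\<close>, \<open>r\<close>.\<close>

lemma twins_connected:
  assumes "{q, r} \<notin> E" "{p, r} \<notin> E" and conn: "connected_in (E - twin_edges) p q"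
  shows "hajos_bounded E"
proof -
  obtain vs where vs: "distinct vs" "vs \<noteq> []" "hd vs = p" "last vs = q"
    "path_edges vs \<subseteq> E - twin_edges"
    using connected_in_path[OF conn] .
  have len: "2 \<le> length vs"
  proof (rule ccontr)
    assume "\<not> 2 \<le> length vs"
    moreover have "length vs \<noteq> 0" using vs(2) by simp
    ultimately have "length vs = 1" by linarith
    then show False using vs(3,4) dist by (auto simp: length_Suc_conv)
  qed
  have notin: "{u, x} \<notin> path_edges vs" "{w, x} \<notin> path_edges vs" for x
  proof -
    have "{u, x} \<notin> E - twin_edges" "{w, x} \<notin> E - twin_edges"
      using dist by (auto simp: cycle_edges_eq edge_iff[OF nu] edge_iff[OF nw] insert_commute)
    then show "{u, x} \<notin> path_edges vs" "{w, x} \<notin> path_edges vs" using vs(5) by blast+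
  qed
  have nb: "nbrs (path_edges vs) u = {}" "nbrs (path_edges vs) w = {}"
    using notin by (auto simp: nbrs_def)
  have "x \<notin> set vs" if "\<And>y. {x, y} \<notin> path_edges vs" for x
  proof
    assume "x \<in> set vs"
    then obtain e where e: "e \<in> path_edges vs" "x \<in> e" using Union_path_edges[OF len] by blast
    then have "e \<in> E" using vs(5) by blast
    then show False using edge_obtain_nbrs[OF even_graph _ e(2)] e(1) that by metis
  qed
  then have uw: "u \<notin> set vs" "w \<notin> set vs" using notin by blast+
  obtain zs where zs: "vs = p # zs" using vs(2,3) by (cases vs) auto
  have C: "cycle_edges (u # vs @ [w]) = insert {w, u} (insert {u, p} (insert {q, w} (path_edges vs)))"
  proof -
    have "path_edges (u # vs @ [w]) = insert {u, p} (path_edges (vs @ [w]))" by (simp add: zs)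
    then show ?thesis using vs(2,4) by (simp add: cycle_edges_eq path_edges_snoc)
  qed
  show ?thesis
  proof (rule remove_circuit_suppress_pair[of "u # vs @ [w]" u q r w p r])
    show "distinct (u # vs @ [w])" using vs(1) uw dist by simp
    show "3 \<le> length (u # vs @ [w])" using len by simp
    have "path_edges vs \<subseteq> E" using vs(5) by blast
    then show "cycle_edges (u # vs @ [w]) \<subseteq> E"
      unfolding C by (simp add: edge_iff[OF nu] edge_iff[OF nw])
  qed (use dist distinct_rev[THEN iffD2, OF dist] assms(1,2) in \<open>simp_all add: C nb nbrs_insert
      nu nw insert_Diff_if doubleton_eq_iff\<close>)
qed

text \<open>Deleting two circuits isolates both twins. The components are then counted on two
  vertices fewer, which pays for the second circuit.\<close>

lemma twins_separated:
  assumes "\<not> connected_in (E - twin_edges) p q" "\<not> connected_in (E - twin_edges) p r"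
    "\<not> connected_in (E - twin_edges) q r"
  shows "hajos_bounded E"
proof -
  let ?A = "cycle_edges [u, w, p]" and ?B = "cycle_edges [u, q, w, r]"
  note neq = dist distinct_rev[THEN iffD2, OF dist]
  have A: "is_circuit ?A" unfolding is_circuit_def
    by (rule exI[of _ "[u, w, p]"]) (use dist in simp)
  have B: "is_circuit ?B" unfolding is_circuit_def
    by (rule exI[of _ "[u, q, w, r]"]) (use neq in simp)
  have AE: "?A \<subseteq> E" and BE: "?B \<subseteq> E - ?A"
    using neq by (simp_all add: cycle_edges_eq edge_iff[OF nu] edge_iff[OF nw] doubleton_eq_iff)
  have F: "E - twin_edges = E - ?A - ?B" by blast
  have even: "even_graph (E - twin_edges)"
    unfolding F by (intro even_graph_Diff_circuit even_graph A B AE BE)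
  have nb: "nbrs (E - twin_edges) u = {}" "nbrs (E - twin_edges) w = {}"
    unfolding nbrs_Diff nu nw using neq by (auto simp: cycle_edges_eq nbrs_def doubleton_eq_iff)
  let ?W = "\<Union>E - {u, w}"
  have "{u, w} \<in> E" "{u, p} \<in> E" "{u, q} \<in> E" "{u, r} \<in> E" using nu by (auto simp: nbrs_def)
  then have in_E: "{u, w, p, q, r} \<subseteq> \<Union>E" by blast
  have "decomposes (E - twin_edges) ((card ?W - 3) div 2)"
  proof (rule three_components[OF even _ assms])
    have "{u, w} \<in> ?A" by (simp add: cycle_edges_eq)
    then show "E - twin_edges \<subset> E" using AE by blast
    show "finite ?W" using finite_vertices by simp
    have "u \<notin> \<Union>(E - twin_edges)" "w \<notin> \<Union>(E - twin_edges)"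
      using nb Union_conv_nbrs[OF even] by simp_all
    then show "\<Union>(E - twin_edges) \<subseteq> ?W" by blast
    show "{p, q, r} \<subseteq> ?W" using in_E neq by auto
  qed
  then have "decomposes E (Suc (Suc ((card ?W - 3) div 2)))"
    unfolding F by (intro decomposes_Diff[OF A AE] decomposes_Diff[OF B BE])
  moreover have "card ?W = card (\<Union>E) - 2"
    using in_E neq finite_vertices by (simp add: card_Diff_subset)
  moreover have "5 \<le> card (\<Union>E)"
    using card_mono[OF finite_vertices in_E] neq by simp
  then have "Suc (Suc ((card (\<Union>E) - 2 - 3) div 2)) = (card (\<Union>E) - 1) div 2" by linarith
  ultimately show ?thesis unfolding hajos_bounded_def by simp
qed

end

lemma bounded_twins:
  assumes nu: "nbrs E u = {w, p, q, r}" and nw: "nbrs E w = {u, p, q, r}"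
    and dist: "distinct [u, w, p, q, r]"
  shows "hajos_bounded E"
proof -
  have perm: "distinct [u, w, q, p, r]" "distinct [u, w, p, r, q]" "distinct [u, w, q, r, p]"
    using dist by auto
  have perm_nbrs: "nbrs E u = {w, q, p, r}" "nbrs E w = {u, q, p, r}" "nbrs E u = {w, p, r, q}"
    "nbrs E w = {u, p, r, q}" "nbrs E u = {w, q, r, p}" "nbrs E w = {u, q, r, p}"
    unfolding nu nw by blast+
  have sym: "{q, p} = {p, q}" "{r, q} = {q, r}" "{r, p} = {p, r}"
    by (simp_all add: insert_commute)
  \<comment> \<open>\<open>twin_edges\<close> does not depend on the order of \<open>p\<close>,
    \<open>q\<close>, \<open>r\<close>, so the permuted lemmas speak of the same graph.\<close>
  have T: "cycle_edges [u, w, p] \<union> cycle_edges [u, r, w, q] =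
      cycle_edges [u, w, p] \<union> cycle_edges [u, q, w, r]"
    "cycle_edges [u, w, q] \<union> cycle_edges [u, r, w, p] =
      cycle_edges [u, w, p] \<union> cycle_edges [u, q, w, r]"
    by (simp_all add: cycle_edges_eq insert_commute)
  note two = twins_two_edges[OF nu nw dist] twins_two_edges[OF perm_nbrs(1,2) perm(1)]
    twins_two_edges[OF perm_nbrs(3,4) perm(2)]
  note one = twins_one_edge[OF nu nw dist] twins_one_edge[OF perm_nbrs(3,4) perm(2)]
    twins_one_edge[OF perm_nbrs(5,6) perm(3)]
  note conn = twins_connected[OF nu nw dist] twins_connected[OF perm_nbrs(3,4) perm(2)]
    twins_connected[OF perm_nbrs(5,6) perm(3)]
  show ?thesis
  proof (cases "{p, q} \<notin> E \<and> {q, r} \<notin> E \<and> {p, r} \<notin> E")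
    case True
    then show ?thesis using conn[unfolded sym T] twins_separated[OF nu nw dist] by blast
  next
    case False
    then show ?thesis using two[unfolded sym] one[unfolded sym] by blast
  qed
qed

lemma hajos_bound: "hajos_bounded E"
proof (cases "diamond_free E")
  case True
  show ?thesis
  proof (cases "\<exists>u w c. w \<in> nbrs E u \<and> c \<in> nbrs E u \<inter> nbrs E w")
    case True
    then obtain u w c where uwc: "w \<in> nbrs E u" "c \<in> nbrs E u \<inter> nbrs E w" by blast
    then have "distinct [u, w, c]" using nbrs_irrefl[OF even_graph] by auto
    then show ?thesis
      using bounded_triangle[OF \<open>diamond_free E\<close>] uwc by (simp add: nbrs_def)
  next
    case no_triangle: False
    show ?thesis
    proof (cases "E = {}")
      case True
      then show ?thesis by (simp add: hajos_bounded_def decomposes.empty)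
    next
      case False
      then show ?thesis by (rule bounded_triangle_free) (use no_triangle in blast)
    qed
  qed
next
  case False
  then obtain u w p q where *: "w \<in> nbrs E u" "{p, q} \<subseteq> nbrs E u \<inter> nbrs E w" "p \<noteq> q"
    unfolding diamond_free_def by blast
  have "u \<in> nbrs E w" using * nbrs_sym[of u E w] by blast
  have neq: "distinct [w, p, q]" "distinct [u, p, q]"
    using * nbrs_irrefl[OF even_graph] by auto
  obtain r where nu: "nbrs E u = {w, p, q, r}" "distinct [u, w, p, q, r]"
    using fourth_nbr[OF even_graph _ neq(1), of u] * by auto
  obtain s where nw: "nbrs E w = {u, p, q, s}" "distinct [w, u, p, q, s]"
    using fourth_nbr[OF even_graph _ neq(2), of w] * \<open>u \<in> nbrs E w\<close> by auto
  show ?thesis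
  \<comment> \<open>Both ends have degree 4 by parity; they are twins exactly when their fourth
    neighbours coincide.\<close>
  proof (cases "r = s")
    case True
    then show ?thesis using bounded_twins nu nw by blast
  next
    case False
    then show ?thesis using nu(2) nw(2) by (intro bounded_diamond_nontwin[OF nu(1) nw(1)]) auto
  qed
qed

end

section \<open>The induction and the transfer to \<open>cn\<close>\<close>

lemma even_graph_hajos_bound: "even_graph E \<Longrightarrow> hajos_bounded E"
proof (induction "card E" arbitrary: E rule: less_induct)
  case less
  then interpret smaller_bounded E by unfold_locales
  show ?case by (rule hajos_bound)
qed

text \<open>The circuit added last is disjoint from the union of the earlier ones, which yields
  pairwise disjointness.\<close>

lemma decomposes_imp_circuits:
  "decomposes E k \<Longrightarrow> \<exists>D. finite D \<and> card D \<le> k \<and> (\<forall>C\<in>D. is_circuit C) \<and> pairwise disjnt D \<and> \<Union>D = E"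
proof (induction rule: decomposes.induct)
  case (empty k)
  then show ?case by (intro exI[of _ "{}"]) simp
next
  case (add C E k)
  then obtain D where D: "finite D" "card D \<le> k" "\<forall>C\<in>D. is_circuit C" "pairwise disjnt D" "\<Union>D = E"
    by blast
  have "disjnt C X \<and> disjnt X C" if "X \<in> D" for X using that add.hyps(2) D(5) by (auto simp: disjnt_def)
  then have "pairwise disjnt (insert C D)" using D(4) by (auto simp: pairwise_insert)
  then show ?case using D add.hyps(1)
    by (intro exI[of _ "insert C D"]) (auto simp: card_insert_if)
qed

lemma degree_eq_card_nbrs:
  assumes "\<forall>e\<in>E. card e = 2"
  shows "degree E v = card (nbrs E v)"
proof -
  have "bij_betw (\<lambda>x. {v, x}) (nbrs E v) {e \<in> E. v \<in> e}"
  proof (rule bij_betw_imageI)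
    show "inj_on (\<lambda>x. {v, x}) (nbrs E v)" by (auto simp: inj_on_def doubleton_eq_iff)
    show "(\<lambda>x. {v, x}) ` nbrs E v = {e \<in> E. v \<in> e}"
    proof
      show "{e \<in> E. v \<in> e} \<subseteq> (\<lambda>x. {v, x}) ` nbrs E v"
      proof
        fix e assume e: "e \<in> {e \<in> E. v \<in> e}"
        then obtain a b where "e = {a, b}" using assms by (auto simp: card_2_iff)
        then have "e = {v, a} \<or> e = {v, b}" using e by auto
        then show "e \<in> (\<lambda>x. {v, x}) ` nbrs E v" using e by (auto simp: nbrs_def)
      qed
    qed (auto simp: nbrs_def)
  qed
  then show ?thesis unfolding degree_def by (simp add: bij_betw_same_card)
qed

theorem theorem4p4:
  fixes V :: "'a set" and E :: "'a set set" and n :: nat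
  assumes "eulerian V E"
    and "n = card {v \<in> V. \<not> isolated E v}"
    and "n \<ge> 1"
    and "max_degree V E \<le> 4"
  shows "cn V E \<le> (n - 1) div 2"
proof -
  have fin: "finite V" and edges: "\<And>e. e \<in> E \<Longrightarrow> e \<subseteq> V" and two: "\<forall>e\<in>E. card e = 2"
    and even: "\<And>v. v \<in> V \<Longrightarrow> even (degree E v)"
    using assms(1) by (auto simp: eulerian_def simple_graph_def)
  have "finite E" using finite_subset[of E "Pow V"] edges fin by auto
  note deg = degree_eq_card_nbrs[OF two]
  have "even (card (nbrs E v)) \<and> card (nbrs E v) \<le> 4" for v
  proof (cases "v \<in> V")
    case True
    then have "degree E v \<le> max_degree V E" using fin by (simp add: max_degree_def)
    then show ?thesis using True even[of v] assms(4) deg by simp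
  next
    \<comment> \<open>Points outside \<open>V\<close> lie on no edge and count as degree 0 in
      \<open>even_graph\<close>.\<close>
    case False
    then have "nbrs E v = {}" using edges by (auto simp: nbrs_def)
    then show ?thesis by simp
  qed
  then have eg: "even_graph E" using \<open>finite E\<close> two by (simp add: even_graph_def)
  \<comment> \<open>This identifies \<open>n\<close> with the vertex count in
    \<open>hajos_bounded\<close>.\<close>
  have "{v \<in> V. \<not> isolated E v} = \<Union>E"
  proof -
    have "isolated E v \<longleftrightarrow> v \<notin> \<Union>E" for v
      unfolding isolated_def deg Union_conv_nbrs[OF eg] using finite_nbrs[OF eg] by simp
    then show ?thesis using edges by blast
  qed
  then have "decomposes E ((n - 1) div 2)"
    using even_graph_hajos_bound[OF eg] assms(2) by (simp add: hajos_bounded_def)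
  then obtain D where D: "card D \<le> (n - 1) div 2" "\<forall>C\<in>D. is_circuit C" "pairwise disjnt D" "\<Union>D = E"
    using decomposes_imp_circuits by blast
  have "is_cycle V E C" if C: "C \<in> D" for C
  proof -
    obtain vs where vs: "distinct vs" "3 \<le> length vs" "C = cycle_edges vs"
      using D(2) C unfolding is_circuit_def by blast
    have "C \<subseteq> E" using D(4) C by blast
    have "set vs = \<Union>C" using Union_cycle_edges[of vs] vs(2,3) by simp
    then have "set vs \<subseteq> V" using \<open>C \<subseteq> E\<close> edges by blast
    then show ?thesis using \<open>C \<subseteq> E\<close> vs unfolding is_cycle_def by blast
  qed
  then have "cycle_decomposition V E D" using D by (simp add: cycle_decomposition_def)
  then have "cn V E \<le> card D" unfolding cn_def by (intro Least_le) blast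
  then show ?thesis using D(1) by simp
qed

end
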